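(* Let $\delta\in\mathbb{C}$, let $N$ be a $\delta$-Novikov algebra over $\mathbb{C}$, and let $I,J$ be two-sided ideals of $N$. Then: (1) $IJ$ is a two-sided ideal of $N$; (2) $[I,J]$ is a two-sided ideal of $N$ if $\delta\neq-1$; (3) the following identities hold for all $x,y,z\in N$: $$[x,y]z+[y,z]x+[z,x]y=0,\qquad x[y,z]+y[z,x]+z[x,y]=0;$$ in particular, $N$ is Lie-admissible.
   Context: A (left) $\delta$-Novikov algebra is a (not necessarily associative) algebra satisfying, for all $x,y,z$, $\delta(xy)z-x(yz)=\delta(yx)z-y(xz)$ and $(xy)z=(xz)y$. Here $[x,y]=xy-yx$; $IJ$ and $[I,J]$ denote the linear spans of all products $xy$, respectively all commutators $[x,y]$, with $x\in I$, $y\in J$. An algebra is Lie-admissible if it is a Lie algebra under the commutator. *)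

theory Defs
  imports Complex_Main
begin

text \<open>
  The underlying vector space of an algebra is the whole type \<open>'a\<close>; the scalar action and the
  product are explicit parameters. No associativity and no unit are assumed. The plain name
  \<open>linear\<close> would refer to real linear maps.
\<close>

locale nonassoc_algebra = vector_space scale
  for scale :: "'k::field \<Rightarrow> 'a::ab_group_add \<Rightarrow> 'a" +
  fixes mult :: "'a \<Rightarrow> 'a \<Rightarrow> 'a"
  assumes linear_mult_left: "Vector_Spaces.linear scale scale (\<lambda>x. mult x y)"
    and linear_mult_right: "Vector_Spaces.linear scale scale (\<lambda>y. mult x y)"

locale delta_novikov_algebra = nonassoc_algebra scale mult
  for scale :: "'k::field \<Rightarrow> 'a::ab_group_add \<Rightarrow> 'a" and mult :: "'a \<Rightarrow> 'a \<Rightarrow> 'a" +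
  fixes \<delta> :: 'k
  assumes left_identity:
      "scale \<delta> (mult (mult x y) z) - mult x (mult y z)
        = scale \<delta> (mult (mult y x) z) - mult y (mult x z)"
    and right_commutative: "mult (mult x y) z = mult (mult x z) y"

locale lie_algebra = nonassoc_algebra scale bracket
  for scale :: "'k::field \<Rightarrow> 'a::ab_group_add \<Rightarrow> 'a" and bracket :: "'a \<Rightarrow> 'a \<Rightarrow> 'a" +
  assumes alternating: "bracket x x = 0"
    and jacobi: "bracket x (bracket y z) + bracket y (bracket z x) + bracket z (bracket x y) = 0"

definition commutator :: "('a::ab_group_add \<Rightarrow> 'a \<Rightarrow> 'a) \<Rightarrow> 'a \<Rightarrow> 'a \<Rightarrow> 'a"
  where "commutator mult x y = mult x y - mult y x"

definition lie_admissible ::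
    "('k::field \<Rightarrow> 'a::ab_group_add \<Rightarrow> 'a) \<Rightarrow> ('a \<Rightarrow> 'a \<Rightarrow> 'a) \<Rightarrow> bool"
  where "lie_admissible scale mult \<longleftrightarrow>
    nonassoc_algebra scale mult \<and> lie_algebra scale (commutator mult)"

definition two_sided_ideal ::
    "('k::field \<Rightarrow> 'a::ab_group_add \<Rightarrow> 'a) \<Rightarrow> ('a \<Rightarrow> 'a \<Rightarrow> 'a) \<Rightarrow> 'a set \<Rightarrow> bool"
  where "two_sided_ideal scale mult I \<longleftrightarrow>
    module.subspace scale I \<and> (\<forall>x\<in>I. \<forall>a. mult a x \<in> I \<and> mult x a \<in> I)"

definition product_span ::
    "('k::field \<Rightarrow> 'a::ab_group_add \<Rightarrow> 'a) \<Rightarrow> ('a \<Rightarrow> 'a \<Rightarrow> 'a) \<Rightarrow> 'a set \<Rightarrow> 'a set \<Rightarrow> 'a set"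
  where "product_span scale mult I J = module.span scale {mult x y | x y. x \<in> I \<and> y \<in> J}"

definition commutator_span ::
    "('k::field \<Rightarrow> 'a::ab_group_add \<Rightarrow> 'a) \<Rightarrow> ('a \<Rightarrow> 'a \<Rightarrow> 'a) \<Rightarrow> 'a set \<Rightarrow> 'a set \<Rightarrow> 'a set"
  where "commutator_span scale mult I J =
    module.span scale {commutator mult x y | x y. x \<in> I \<and> y \<in> J}"

end

theory Submission
  imports Defs
begin

text \<open>
  Write \<open>xy\<close> for the product. The left identity says \<open>\<delta>[x,y]z = x(yz) - y(xz)\<close>.

  The cyclic sum of \<open>[x,y]z\<close> consists of three pairs that cancel by right commutativity. By the
  left identity the cyclic sum of \<open>x[y,z]\<close> is \<open>\<delta>\<close> times that sum, hence zero as well, and the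
  Jacobi expression is the difference of the two cyclic sums.

  For ideals \<open>I\<close> and \<open>J\<close>, the identities exchange the outer factor with a factor from an ideal:
  \<open>(ij)a = (ia)j\<close>, and \<open>a(ij) = i(aj) + \<delta>((ai)j - (ia)j)\<close>. This settles \<open>IJ\<close>.

  For \<open>[I,J]\<close>, work modulo this subspace, where an element of \<open>I\<close> and an element of \<open>J\<close> commute.
  Right commutativity gives \<open>[i,j]a = (ia)j - (ja)i \<equiv> j(ia) - i(ja) = -\<delta>[i,j]a\<close>, so
  \<open>(1 + \<delta>)[i,j]a\<close> lies in \<open>[I,J]\<close>, and \<open>1 + \<delta>\<close> can be divided out. The Jacobi identity shows
  \<open>[[i,j],a] \<in> [I,J]\<close>, which transfers the conclusion to \<open>a[i,j]\<close>.
\<close>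

context nonassoc_algebra
begin

lemma module_hom_mult_left: "module_hom scale scale (\<lambda>x. mult x y)"
  using linear_mult_left by (simp add: linear_iff_module_hom)

lemma module_hom_mult_right: "module_hom scale scale (\<lambda>y. mult x y)"
  using linear_mult_right by (simp add: linear_iff_module_hom)

lemmas mult_add_left = module_hom.add[OF module_hom_mult_left]
  and mult_add_right = module_hom.add[OF module_hom_mult_right]
  and mult_diff_left = module_hom.diff[OF module_hom_mult_left]
  and mult_diff_right = module_hom.diff[OF module_hom_mult_right]
  and mult_scale_left = module_hom.scale[OF module_hom_mult_left]
  and mult_scale_right = module_hom.scale[OF module_hom_mult_right]

lemma nonassoc_algebra_commutator: "nonassoc_algebra scale (commutator mult)"
  by unfold_locales
    (simp_all add: commutator_def mult_add_left mult_add_right mult_scale_left mult_scale_right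
      scale_right_diff_distrib)

text \<open>
  Multiplication by a fixed element is linear, so absorption need only be tested on spanning
  vectors; both ideals below are given as spans.
\<close>
lemma two_sided_ideal_span:
  assumes "\<And>s a. s \<in> S \<Longrightarrow> mult a s \<in> span S"
    and "\<And>s a. s \<in> S \<Longrightarrow> mult s a \<in> span S"
  shows "two_sided_ideal scale mult (span S)"
  unfolding two_sided_ideal_def
proof (intro conjI ballI allI)
  show "subspace (span S)"
    by (rule subspace_span)
next
  fix x a
  assume x: "x \<in> span S"
  show "mult a x \<in> span S"
    using module_hom.span_image[OF module_hom_mult_right, of a S] x
      span_mono[of "mult a ` S" "span S"] assms(1) by (auto simp: span_span)
  show "mult x a \<in> span S"
    using module_hom.span_image[OF module_hom_mult_left, of a S] x
      span_mono[of "(\<lambda>x. mult x a) ` S" "span S"] assms(2) by (auto simp: span_span)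
qed

end

context delta_novikov_algebra
begin

lemma left_identity_commutator:
  "scale \<delta> (mult (commutator mult x y) z) = mult x (mult y z) - mult y (mult x z)"
  using left_identity[of x y z]
  by (simp add: commutator_def mult_diff_left scale_right_diff_distrib algebra_simps)

lemma cyclic_commutator_mult:
  "mult (commutator mult x y) z + mult (commutator mult y z) x
    + mult (commutator mult z x) y = 0"
  using right_commutative[of x y z] right_commutative[of y z x] right_commutative[of z x y]
  by (simp add: commutator_def mult_diff_left)

text \<open>
  By the left identity, the six products here regroup into \<open>\<delta>\<close> times the cyclic sum of the
  \<open>[x,y]z\<close>.
\<close>
lemma cyclic_mult_commutator:
  "mult x (commutator mult y z) + mult y (commutator mult z x)
    + mult z (commutator mult x y) = 0"
proof -
  have "mult x (commutator mult y z) + mult y (commutator mult z x)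
      + mult z (commutator mult x y)
    = scale \<delta> (mult (commutator mult x y) z) + scale \<delta> (mult (commutator mult y z) x)
      + scale \<delta> (mult (commutator mult z x) y)"
    unfolding left_identity_commutator by (simp add: commutator_def mult_diff_right)
  also have "\<dots> = scale \<delta> (mult (commutator mult x y) z + mult (commutator mult y z) x
      + mult (commutator mult z x) y)"
    by (simp add: scale_right_distrib)
  finally show ?thesis
    by (simp add: cyclic_commutator_mult)
qed

text \<open>
  As \<open>[x,[y,z]] = x[y,z] - [y,z]x\<close>, this is the difference of the two vanishing cyclic sums.
\<close>
lemma commutator_jacobi:
  "commutator mult x (commutator mult y z) + commutator mult y (commutator mult z x)
    + commutator mult z (commutator mult x y) = 0"
proof -
  have "commutator mult x (commutator mult y z) + commutator mult y (commutator mult z x)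
      + commutator mult z (commutator mult x y)
    = (mult x (commutator mult y z) + mult y (commutator mult z x)
        + mult z (commutator mult x y))
      - (mult (commutator mult x y) z + mult (commutator mult y z) x
        + mult (commutator mult z x) y)"
    by (simp add: commutator_def[of mult _ "commutator mult _ _"])
  then show ?thesis
    by (simp add: cyclic_commutator_mult cyclic_mult_commutator)
qed

lemma lie_admissible: "lie_admissible scale mult"
proof -
  interpret C: nonassoc_algebra scale "commutator mult"
    by (rule nonassoc_algebra_commutator)
  have "lie_algebra scale (commutator mult)"
    by unfold_locales (simp add: commutator_def, rule commutator_jacobi)
  then show ?thesis
    by (simp add: lie_admissible_def nonassoc_algebra_axioms)
qed

text \<open>
  A factor \<open>a\<close> multiplying \<open>ij\<close> can be moved onto \<open>i\<close> or \<open>j\<close>, where the ideal absorbs it: from the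
  right by right commutativity, from the left by the left identity.
\<close>
lemma two_sided_ideal_product_span:
  assumes "two_sided_ideal scale mult I" and "two_sided_ideal scale mult J"
  shows "two_sided_ideal scale mult (product_span scale mult I J)"
  unfolding product_span_def
proof (rule two_sided_ideal_span)
  let ?S = "{mult x y | x y. x \<in> I \<and> y \<in> J}"
  fix s a
  assume "s \<in> ?S"
  then obtain i j where s: "s = mult i j" and i: "i \<in> I" and j: "j \<in> J"
    by blast
  have "mult i a \<in> I" "mult a i \<in> I" "mult a j \<in> J"
    using assms i j by (auto simp: two_sided_ideal_def)
  then have mem: "mult (mult i a) j \<in> span ?S" "mult (mult a i) j \<in> span ?S"
      "mult i (mult a j) \<in> span ?S"
    using i j by (auto intro!: span_base)
  show "mult s a \<in> span ?S"
    using mem(1) by (simp add: s right_commutative[of i j a])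
  have "mult a s = mult i (mult a j)
      + (scale \<delta> (mult (mult a i) j) - scale \<delta> (mult (mult i a) j))"
    using left_identity[of a i j] by (simp add: s algebra_simps)
  then show "mult a s \<in> span ?S"
    using mem by (simp add: span_add span_diff span_scale)
qed

text \<open>
  Right commutativity makes \<open>[i,j]a\<close> the element \<open>(ia)j - (ja)i\<close>, and the left identity makes
  \<open>\<delta>[i,j]a\<close> the element \<open>i(ja) - j(ia)\<close>. Their sum is \<open>[ia,j] + [i,ja]\<close>, so the hypothesis on \<open>\<delta>\<close>
  is what allows \<open>[i,j]a\<close> itself to be recovered.
\<close>
lemma two_sided_ideal_commutator_span:
  assumes "\<delta> \<noteq> -1"
    and "two_sided_ideal scale mult I" and "two_sided_ideal scale mult J"
  shows "two_sided_ideal scale mult (commutator_span scale mult I J)"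
  unfolding commutator_span_def
proof (rule two_sided_ideal_span)
  let ?S = "{commutator mult x y | x y. x \<in> I \<and> y \<in> J}"
  fix s a
  assume "s \<in> ?S"
  then obtain i j where s: "s = commutator mult i j" and i: "i \<in> I" and j: "j \<in> J"
    by blast
  have I: "mult i a \<in> I" "commutator mult a i \<in> I" and J: "mult j a \<in> J" "commutator mult j a \<in> J"
    using assms(2,3) i j by (auto simp: two_sided_ideal_def commutator_def subspace_diff)
  have comm: "commutator mult x y \<in> span ?S" if "x \<in> I" "y \<in> J" for x y
    using that by (auto intro!: span_base)

  have "scale (1 + \<delta>) (mult s a) = mult s a + scale \<delta> (mult s a)"
    by (simp add: scale_left_distrib)
  also have "\<dots> = commutator mult (mult i a) j + commutator mult i (mult j a)"
    unfolding s left_identity_commutator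
    by (simp add: commutator_def mult_diff_left right_commutative[of i j a]
        right_commutative[of j i a])
  also have "\<dots> \<in> span ?S"
    using I J i j by (intro span_add comm)
  finally have "scale (inverse (1 + \<delta>)) (scale (1 + \<delta>) (mult s a)) \<in> span ?S"
    by (rule span_scale)
  moreover have "1 + \<delta> \<noteq> 0"
    using assms(1) by (simp add: add_eq_0_iff)
  ultimately show sa: "mult s a \<in> span ?S"
    by simp

  \<comment> \<open>Bracketing with \<open>a\<close> is a derivation of the bracket, so it keeps \<open>[I,J]\<close> invariant;
    \<open>as\<close> differs from \<open>sa\<close> by such a bracket.\<close>
  have "commutator mult a s = commutator mult (commutator mult a i) j
      - commutator mult i (commutator mult j a)"
    using commutator_jacobi[of a i j]
    by (simp add: s commutator_def[of mult j "commutator mult a i"]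
        commutator_def[of mult "commutator mult a i" j] algebra_simps eq_neg_iff_add_eq_0)
  also have "\<dots> \<in> span ?S"
    using I J i j by (intro span_diff comm)
  finally have "commutator mult a s + mult s a \<in> span ?S"
    using sa by (rule span_add)
  then show "mult a s \<in> span ?S"
    by (simp add: commutator_def)
qed

end

theorem lemma7:
  fixes scale :: "complex \<Rightarrow> 'a::ab_group_add \<Rightarrow> 'a"
    and mult :: "'a \<Rightarrow> 'a \<Rightarrow> 'a"
    and \<delta> :: complex
    and I J :: "'a set"
  assumes "delta_novikov_algebra scale mult \<delta>"
    and "two_sided_ideal scale mult I"
    and "two_sided_ideal scale mult J"
  shows "two_sided_ideal scale mult (product_span scale mult I J)
    \<and> (\<delta> \<noteq> -1 \<longrightarrow> two_sided_ideal scale mult (commutator_span scale mult I J))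
    \<and> (\<forall>x y z.
          mult (commutator mult x y) z + mult (commutator mult y z) x
            + mult (commutator mult z x) y = 0
        \<and> mult x (commutator mult y z) + mult y (commutator mult z x)
            + mult z (commutator mult x y) = 0)
    \<and> lie_admissible scale mult"
proof -
  interpret delta_novikov_algebra scale mult \<delta>
    by fact
  show ?thesis
    using assms(2,3)
    by (simp add: two_sided_ideal_product_span two_sided_ideal_commutator_span
        cyclic_commutator_mult cyclic_mult_commutator lie_admissible)
qed

end
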